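(* Let $p\in[1,\infty)$ and let $\psi:[0,1/2]\to[0,\infty)$ be a measurable function, not Lebesgue-almost everywhere zero, such that $$\kappa_\psi^+ := \int_0^{1/2}\psi(\alpha)\,\frac{1-2\alpha}{\alpha(1-\alpha)}\,d\alpha<\infty .$$ Define $I^e_\psi: L^p_+(\mathbf P)\to\mathbb R$ by $I^e_\psi(0)=0$ and, for $X\in L^p_+(\mathbf P)\setminus\{0\}$, $$I^e_\psi(X)=\frac{1}{\kappa_\psi^+}\int_0^{1/2}\psi(\alpha)\,\big[e_{\widetilde X}(1-\alpha)-e_{\widetilde X}(\alpha)\big]\,d\alpha,\qquad \widetilde X=\frac{X}{\mathbf E[X]}.$$ Then $I^e_\psi$ is a law-invariant generalized inequality index, that is: $I^e_\psi(X)$ depends only on the law of $X$ under $\mathbf P$; and 1. (normalization) $I^e_\psi(X)\in[0,1]$ for every $X\in L^p_+(\mathbf P)$; 2. (scale invariance) $I^e_\psi(tX)=I^e_\psi(X)$ for every $X\in L^p_+(\mathbf P)$ and $t>0$; 3. (convex-order consistency) for all $X,Y\in L^p_+(\mathbf P)$, if $X\le_{\mathrm{cx}}Y$ then $I^e_\psi(X)\le I^e_\psi(Y)$.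
   Context: $(\Omega,\mathcal A,\mathbf P)$ is a complete probability space; $L^p_+(\mathbf P)$ is the set of nonnegative real random variables with finite $p$-th moment, identified up to $\mathbf P$-a.s. equality. Write $a_+=\max\{0,a\}$, $a_-=\max\{0,-a\}$. For an integrable real random variable $X$ and $\alpha\in(0,1)$, the $\alpha$-expectile $e_X(\alpha)$ is the unique real number satisfying $(1-\alpha)\,\mathbf E[(X-e_X(\alpha))_-]=\alpha\,\mathbf E[(X-e_X(\alpha))_+]$. The convex order: $X\le_{\mathrm{cx}}Y$ means $\mathbf E[\phi(X)]\le\mathbf E[\phi(Y)]$ for every convex $\phi:\mathbb R\to\mathbb R$. *)

theory Defs
  imports "HOL-Probability.Probability"
begin

text \<open>
  Random variables are represented by functions rather than by almost-sure equivalence classes;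
  accordingly nonnegativity is required almost surely, and ``the zero random variable'' means
  a random variable that vanishes almost surely.
\<close>

definition Lp_nonneg :: "'a measure \<Rightarrow> real \<Rightarrow> ('a \<Rightarrow> real) set" where
  "Lp_nonneg M p = {X \<in> borel_measurable M.
     (AE \<omega> in M. 0 \<le> X \<omega>) \<and> integrable M (\<lambda>\<omega>. \<bar>X \<omega>\<bar> powr p)}"

text \<open>
  For integrable \<open>X\<close> and \<open>0 < \<alpha> < 1\<close> the number described below exists and is unique;
  outside this range the value is irrelevant.
\<close>

definition expectile :: "'a measure \<Rightarrow> ('a \<Rightarrow> real) \<Rightarrow> real \<Rightarrow> real" where
  "expectile M X \<alpha> = (THE e.
     (1 - \<alpha>) * (\<integral>\<omega>. max 0 (- (X \<omega> - e)) \<partial>M) = \<alpha> * (\<integral>\<omega>. max 0 (X \<omega> - e) \<partial>M))"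

text \<open>
  The Bochner integral of a non-integrable function is \<open>0\<close>, so the convex order is formulated
  with extended-real expectations \<open>E[Z] = E[Z\<^sub>+] - E[Z\<^sub>-]\<close> (\<open>ennreal\<close> maps negative
  reals to \<open>0\<close>). If \<open>X\<close> is integrable on a probability space and \<open>\<phi>\<close> is convex, then
  \<open>\<phi>(X)\<close> has an integrable minorant, hence \<open>E[\<phi>(X)\<^sub>-] < \<infinity>\<close> and
  \<open>\<infinity> - \<infinity>\<close> does not arise.
\<close>

definition ext_expectation :: "'a measure \<Rightarrow> ('a \<Rightarrow> real) \<Rightarrow> ereal" where
  "ext_expectation M Z =
     enn2ereal (\<integral>\<^sup>+\<omega>. ennreal (Z \<omega>) \<partial>M) - enn2ereal (\<integral>\<^sup>+\<omega>. ennreal (- Z \<omega>) \<partial>M)"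

definition convex_order :: "'a measure \<Rightarrow> ('a \<Rightarrow> real) \<Rightarrow> ('a \<Rightarrow> real) \<Rightarrow> bool" where
  "convex_order M X Y \<longleftrightarrow>
     (\<forall>\<phi> :: real \<Rightarrow> real. convex_on UNIV \<phi> \<longrightarrow>
        ext_expectation M (\<lambda>\<omega>. \<phi> (X \<omega>)) \<le> ext_expectation M (\<lambda>\<omega>. \<phi> (Y \<omega>)))"

text \<open>The integrands below are not meaningful at \<open>\<alpha> = 0\<close>, which is a null set.\<close>

definition kappa_plus :: "(real \<Rightarrow> real) \<Rightarrow> ennreal" where
  "kappa_plus \<psi> =
     (\<integral>\<^sup>+\<alpha>. ennreal (\<psi> \<alpha> * ((1 - 2 * \<alpha>) / (\<alpha> * (1 - \<alpha>)))) \<partial>lebesgue_on {0..1/2})"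

definition expectile_spread :: "'a measure \<Rightarrow> ('a \<Rightarrow> real) \<Rightarrow> real \<Rightarrow> real" where
  "expectile_spread M X \<alpha> = expectile M X (1 - \<alpha>) - expectile M X \<alpha>"

definition normalized :: "'a measure \<Rightarrow> ('a \<Rightarrow> real) \<Rightarrow> 'a \<Rightarrow> real" where
  "normalized M X = (\<lambda>\<omega>. X \<omega> / (\<integral>\<omega>'. X \<omega>' \<partial>M))"

definition expectile_index :: "'a measure \<Rightarrow> (real \<Rightarrow> real) \<Rightarrow> ('a \<Rightarrow> real) \<Rightarrow> real" where
  "expectile_index M \<psi> X =
     (if AE \<omega> in M. X \<omega> = 0 then 0
      else 1 / enn2real (kappa_plus \<psi>) *
        (\<integral>\<alpha>. \<psi> \<alpha> * expectile_spread M (normalized M X) \<alpha> \<partial>lebesgue_on {0..1/2}))"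

end

(* The expectile e_X(\<alpha>) is the root e of the strictly increasing function
     (1 - \<alpha>) E[(X - e)_-] - \<alpha> E[(X - e)_+] = (1 - \<alpha>) (e - E[X]) + (1 - 2 \<alpha>) E[(X - e)_+],
   so expectiles of variables with a common mean are compared by comparing stop-loss transforms
   E[(X - e)_+]. For E[X] = 1 and X \<ge> 0 the bound E[(X - e)_+] \<le> 1 for e \<ge> 0 gives
   \<alpha> / (1 - \<alpha>) \<le> e_X(\<alpha>) and e_X(1 - \<alpha>) \<le> (1 - \<alpha>) / \<alpha>, whose difference is the weight in
   kappa_plus. *)

theory Submission
  imports Defs
begin

section \<open>Stop-loss transforms and the gap function\<close>

definition stop_loss :: "'a measure \<Rightarrow> ('a \<Rightarrow> real) \<Rightarrow> real \<Rightarrow> real" where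
  "stop_loss M X e = (\<integral>\<omega>. max 0 (X \<omega> - e) \<partial>M)"

definition expectile_gap :: "'a measure \<Rightarrow> ('a \<Rightarrow> real) \<Rightarrow> real \<Rightarrow> real \<Rightarrow> real" where
  "expectile_gap M X \<alpha> e =
     (1 - \<alpha>) * (\<integral>\<omega>. max 0 (- (X \<omega> - e)) \<partial>M) - \<alpha> * (\<integral>\<omega>. max 0 (X \<omega> - e) \<partial>M)"

lemma expectile_eq_THE_gap: "expectile M X \<alpha> = (THE e. expectile_gap M X \<alpha> e = 0)"
  unfolding expectile_def expectile_gap_def by (rule arg_cong[of _ _ The]) auto

context prob_space
begin

lemma integrable_stop_loss:
  fixes X :: "'a \<Rightarrow> real"
  assumes "integrable M X"
  shows "integrable M (\<lambda>\<omega>. max 0 (X \<omega> - e))"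
  using assms by (intro integrable_max) auto

text \<open>Pointwise, max 0 (-a) = max 0 a - a, so the lower partial moment is eliminated and
  \<open>X\<close> enters only through its mean and its stop-loss transform.\<close>

lemma expectile_gap_eq:
  assumes "integrable M X"
  shows "expectile_gap M X \<alpha> e = (1 - \<alpha>) * (e - expectation X) + (1 - 2 * \<alpha>) * stop_loss M X e"
proof -
  have "(\<integral>\<omega>. max 0 (- (X \<omega> - e)) \<partial>M) = (\<integral>\<omega>. max 0 (X \<omega> - e) - (X \<omega> - e) \<partial>M)"
    by (rule arg_cong[of _ _ "integral\<^sup>L M"]) (auto simp: max_def)
  also have "\<dots> = stop_loss M X e - (expectation X - e)"
    using assms integrable_stop_loss[OF assms] by (simp add: stop_loss_def prob_space)
  finally have "(\<integral>\<omega>. max 0 (- (X \<omega> - e)) \<partial>M) = stop_loss M X e - (expectation X - e)" .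
  then show ?thesis
    unfolding expectile_gap_def stop_loss_def by (simp only:) (simp add: algebra_simps)
qed

text \<open>Both bounds hold under the integral: the map from e to max 0 (x - e) is decreasing and
  1-Lipschitz for each x.\<close>

lemma stop_loss_increment:
  assumes "integrable M X" "e \<le> e'"
  shows "stop_loss M X e' \<le> stop_loss M X e" "stop_loss M X e \<le> stop_loss M X e' + (e' - e)"
proof -
  note int = integrable_stop_loss[OF assms(1)]
  show "stop_loss M X e' \<le> stop_loss M X e"
    unfolding stop_loss_def using assms(2) by (intro integral_mono int) auto
  have "stop_loss M X e \<le> (\<integral>\<omega>. max 0 (X \<omega> - e') + (e' - e) \<partial>M)"
    unfolding stop_loss_def using assms(2) int by (intro integral_mono) auto
  then show "stop_loss M X e \<le> stop_loss M X e' + (e' - e)"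
    using int by (simp add: stop_loss_def prob_space)
qed

lemma continuous_stop_loss:
  assumes "integrable M X"
  shows "continuous_on UNIV (stop_loss M X)"
proof -
  have "dist (stop_loss M X x) (stop_loss M X y) \<le> 1 * dist x y" for x y
    using stop_loss_increment[OF assms, of x y] stop_loss_increment[OF assms, of y x]
    by (cases "x \<le> y") (auto simp: dist_real_def)
  then have "1-lipschitz_on UNIV (stop_loss M X)"
    by (intro lipschitz_onI) auto
  then show ?thesis by (rule lipschitz_on_continuous_on)
qed

section \<open>Growth of the gap; existence and uniqueness of expectiles\<close>

lemma expectile_gap_increment:
  assumes "integrable M X" "e \<le> e'"
  shows "min \<alpha> (1 - \<alpha>) * (e' - e) \<le> expectile_gap M X \<alpha> e' - expectile_gap M X \<alpha> e"
proof -
  define D where "D = stop_loss M X e - stop_loss M X e'"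
  have D: "0 \<le> D" "D \<le> e' - e"
    using stop_loss_increment[OF assms] by (auto simp: D_def)
  \<comment> \<open>For e < e' the slope is (1 - \<alpha>) - (1 - 2 \<alpha>) s with s = D / (e' -
    e) in [0, 1], a convex combination of 1 - \<alpha> and \<alpha>. The sign of 1 - 2 \<alpha>
    decides which end of the range of \<open>D\<close> is the worst case.\<close>
  have *: "expectile_gap M X \<alpha> e' - expectile_gap M X \<alpha> e = (1 - \<alpha>) * (e' - e) - (1 - 2 * \<alpha>) * D"
    by (simp add: expectile_gap_eq[OF assms(1)] D_def algebra_simps)
  show ?thesis
  proof (cases "\<alpha> \<le> 1 / 2")
    case True
    then have "(1 - 2 * \<alpha>) * D \<le> (1 - 2 * \<alpha>) * (e' - e)"
      using D by (intro mult_left_mono) auto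
    then show ?thesis
      unfolding * using True by (simp add: min_def algebra_simps)
  next
    case False
    then have "(1 - 2 * \<alpha>) * D \<le> 0"
      using D by (intro mult_nonpos_nonneg) auto
    then show ?thesis
      unfolding * using False by (simp add: min_def)
  qed
qed

lemma expectile_gap_strict_mono:
  assumes "integrable M X" "0 < \<alpha>" "\<alpha> < 1"
  shows "strict_mono (expectile_gap M X \<alpha>)"
proof (rule strict_monoI)
  fix e e' :: real
  assume "e < e'"
  then have "0 < min \<alpha> (1 - \<alpha>) * (e' - e)"
    using assms by simp
  with expectile_gap_increment[OF assms(1), of e e' \<alpha>] \<open>e < e'\<close>
  show "expectile_gap M X \<alpha> e < expectile_gap M X \<alpha> e'" by simp
qed

lemma expectile_gap_root:
  assumes "integrable M X" "0 < \<alpha>" "\<alpha> < 1"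
  shows "\<exists>e. expectile_gap M X \<alpha> e = 0"
proof -
  define c where "c = min \<alpha> (1 - \<alpha>)"
  have c: "c > 0" using assms by (simp add: c_def)
  let ?g = "expectile_gap M X \<alpha>"
  \<comment> \<open>As the gap grows at rate at least \<open>c\<close>, moving a distance |g(0)| / c
    to either side of 0 compensates its value there, so [-d, d] brackets a root.\<close>
  define d where "d = \<bar>?g 0\<bar> / c"
  have d: "0 \<le> d" "c * d = \<bar>?g 0\<bar>" using c by (auto simp: d_def)
  have "continuous_on UNIV ?g"
    unfolding expectile_gap_eq[OF assms(1), abs_def]
    by (intro continuous_intros continuous_stop_loss assms)
  then have "\<And>x. isCont ?g x" by (simp add: continuous_on_eq_continuous_at)
  moreover have "?g (- d) \<le> 0"
    using expectile_gap_increment[OF assms(1), of "- d" 0 \<alpha>] d by (simp add: c_def)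
  moreover have "0 \<le> ?g d"
    using expectile_gap_increment[OF assms(1), of 0 d \<alpha>] d by (simp add: c_def)
  ultimately show ?thesis
    using IVT[of ?g "- d" 0 d] d(1) by auto
qed

text \<open>Strict monotonicity makes the root unique, so the definite description in
  \<open>expectile\<close> denotes it.\<close>

lemma expectile_gap_expectile:
  assumes "integrable M X" "0 < \<alpha>" "\<alpha> < 1"
  shows "expectile_gap M X \<alpha> (expectile M X \<alpha>) = 0"
proof -
  obtain e where e: "expectile_gap M X \<alpha> e = 0"
    using expectile_gap_root[OF assms] by blast
  have "expectile M X \<alpha> = e"
    unfolding expectile_eq_THE_gap
    using e strict_mono_eq[OF expectile_gap_strict_mono[OF assms]] by (intro the_equality) metis+
  then show ?thesis using e by simp
qed

text \<open>An increasing function lies below its root exactly where it is nonpositive. This and the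
  next lemma turn every bound on an expectile into a sign check of the gap at one point.\<close>

lemma le_expectile_iff:
  assumes "integrable M X" "0 < \<alpha>" "\<alpha> < 1"
  shows "e \<le> expectile M X \<alpha> \<longleftrightarrow> expectile_gap M X \<alpha> e \<le> 0"
  using strict_mono_less_eq[OF expectile_gap_strict_mono[OF assms], of e "expectile M X \<alpha>"]
    expectile_gap_expectile[OF assms] by simp

lemma expectile_le_iff:
  assumes "integrable M X" "0 < \<alpha>" "\<alpha> < 1"
  shows "expectile M X \<alpha> \<le> e \<longleftrightarrow> 0 \<le> expectile_gap M X \<alpha> e"
  using strict_mono_less_eq[OF expectile_gap_strict_mono[OF assms], of "expectile M X \<alpha>" e]
    expectile_gap_expectile[OF assms] by simp

section \<open>Dependence on the level; bounds, comparison and measurability of the spread\<close>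

lemma expectile_mono:
  assumes "integrable M X" "0 < \<alpha>" "\<alpha> \<le> \<beta>" "\<beta> < 1"
  shows "expectile M X \<alpha> \<le> expectile M X \<beta>"
proof -
  let ?e = "expectile M X \<alpha>"
  let ?l = "\<integral>\<omega>. max 0 (- (X \<omega> - ?e)) \<partial>M" and ?u = "\<integral>\<omega>. max 0 (X \<omega> - ?e) \<partial>M"
  \<comment> \<open>Both partial moments are nonnegative, so raising the level at a fixed point
    lowers the gap; at the \<alpha>-expectile it drops from 0 to a nonpositive value.\<close>
  have "(1 - \<beta>) * ?l \<le> (1 - \<alpha>) * ?l" "\<alpha> * ?u \<le> \<beta> * ?u"
    using assms by (auto intro!: mult_right_mono integral_nonneg_AE)
  then have "expectile_gap M X \<beta> ?e \<le> expectile_gap M X \<alpha> ?e"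
    unfolding expectile_gap_def by linarith
  then show ?thesis
    using le_expectile_iff[of X \<beta> ?e] expectile_gap_expectile[of X \<alpha>] assms by simp
qed

lemma expectile_spread_nonneg:
  assumes "integrable M X" "0 < \<alpha>" "\<alpha> \<le> 1 / 2"
  shows "0 \<le> expectile_spread M X \<alpha>"
  using expectile_mono[of X \<alpha> "1 - \<alpha>"] assms by (simp add: expectile_spread_def)

lemma expectile_spread_le:
  assumes X: "integrable M X" "AE \<omega> in M. 0 \<le> X \<omega>" "expectation X = 1"
    and \<alpha>: "0 < \<alpha>" "\<alpha> \<le> 1 / 2"
  shows "expectile_spread M X \<alpha> \<le> (1 - 2 * \<alpha>) / (\<alpha> * (1 - \<alpha>))"
proof -
  have U: "stop_loss M X e \<le> 1" if "0 \<le> e" for e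
  proof -
    have "stop_loss M X e \<le> expectation X"
      unfolding stop_loss_def
    proof (intro integral_mono_AE integrable_stop_loss X(1))
      show "AE \<omega> in M. max 0 (X \<omega> - e) \<le> X \<omega>"
        using X(2) by eventually_elim (use that in auto)
    qed
    then show ?thesis using X(3) by simp
  qed
  \<comment> \<open>The point \<alpha> / (1 - \<alpha>) is the root of the gap once the stop-loss
    value is replaced by its bound 1; it is nonnegative, as \<open>U\<close> demands.\<close>
  have "(1 - 2 * \<alpha>) * stop_loss M X (\<alpha> / (1 - \<alpha>)) \<le> (1 - 2 * \<alpha>) * 1"
    using \<alpha> by (intro mult_left_mono U) auto
  moreover have "(1 - \<alpha>) * (\<alpha> / (1 - \<alpha>) - 1) = - (1 - 2 * \<alpha>)"
    using \<alpha> by (simp add: field_simps)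
  ultimately have "\<alpha> / (1 - \<alpha>) \<le> expectile M X \<alpha>"
    using \<alpha> X by (subst le_expectile_iff) (auto simp: expectile_gap_eq)
  \<comment> \<open>At level 1 - \<alpha> the stop-loss coefficient is -(1 - 2 \<alpha>), so the
    same bound now estimates the gap from below and the expectile from above.\<close>
  moreover have "(1 - 2 * \<alpha>) * stop_loss M X ((1 - \<alpha>) / \<alpha>) \<le> (1 - 2 * \<alpha>) * 1"
    using \<alpha> by (intro mult_left_mono U) auto
  moreover have "\<alpha> * ((1 - \<alpha>) / \<alpha> - 1) = 1 - 2 * \<alpha>"
    using \<alpha> by (simp add: field_simps)
  ultimately have "expectile M X (1 - \<alpha>) \<le> (1 - \<alpha>) / \<alpha>"
    using \<alpha> X by (subst expectile_le_iff) (auto simp: expectile_gap_eq algebra_simps)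
  with \<open>\<alpha> / (1 - \<alpha>) \<le> expectile M X \<alpha>\<close>
  have "expectile_spread M X \<alpha> \<le> (1 - \<alpha>) / \<alpha> - \<alpha> / (1 - \<alpha>)"
    by (simp add: expectile_spread_def)
  also have "\<dots> = (1 - 2 * \<alpha>) / (\<alpha> * (1 - \<alpha>))"
    using \<alpha> by (simp add: field_simps)
  finally show ?thesis .
qed

text \<open>With equal means the two gaps differ only in the stop-loss term, whose coefficient has
  opposite signs at levels \<alpha> and 1 - \<alpha>. Larger stop-loss values thus push the lower
  expectile down and the upper one up.\<close>

lemma expectile_spread_mono_stop_loss:
  assumes "integrable M X" "integrable M Y" "expectation X = expectation Y"
    and le: "\<And>e. stop_loss M X e \<le> stop_loss M Y e"
    and \<alpha>: "0 < \<alpha>" "\<alpha> \<le> 1 / 2"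
  shows "expectile_spread M X \<alpha> \<le> expectile_spread M Y \<alpha>"
proof -
  have *: "(1 - 2 * \<alpha>) * stop_loss M X e \<le> (1 - 2 * \<alpha>) * stop_loss M Y e" for e
    using \<alpha> by (intro mult_left_mono le) auto
  have "expectile_gap M X \<alpha> (expectile M Y \<alpha>) \<le> expectile_gap M Y \<alpha> (expectile M Y \<alpha>)"
    using * assms by (simp add: expectile_gap_eq)
  then have "expectile M Y \<alpha> \<le> expectile M X \<alpha>"
    using assms by (simp add: le_expectile_iff expectile_gap_expectile)
  moreover have "expectile_gap M Y (1 - \<alpha>) (expectile M X (1 - \<alpha>))
      \<le> expectile_gap M X (1 - \<alpha>) (expectile M X (1 - \<alpha>))"
    using *[of "expectile M X (1 - \<alpha>)"] assms by (simp add: expectile_gap_eq algebra_simps)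
  then have "expectile M X (1 - \<alpha>) \<le> expectile M Y (1 - \<alpha>)"
    using assms by (simp add: le_expectile_iff expectile_gap_expectile)
  ultimately show ?thesis by (simp add: expectile_spread_def)
qed

text \<open>As \<alpha> grows to 1/2 the two expectiles approach each other, so the negated spread
  is monotone on (0, 1/2] and hence Borel there.\<close>

lemma borel_measurable_expectile_spread:
  assumes "integrable M X"
  shows "expectile_spread M X \<in> borel_measurable (lebesgue_on {0..1/2})"
proof -
  let ?f = "expectile_spread M X" and ?A = "{0<..1/2::real}"
  have "mono_on ?A (\<lambda>\<alpha>. - ?f \<alpha>)"
  proof (rule mono_onI)
    fix r s :: real
    assume "r \<in> ?A" "s \<in> ?A" "r \<le> s"
    then show "- ?f r \<le> - ?f s"
      using expectile_mono[OF assms, of r s] expectile_mono[OF assms, of "1 - s" "1 - r"]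
      by (simp add: expectile_spread_def)
  qed
  then have "(\<lambda>\<alpha>. - ?f \<alpha>) \<in> borel_measurable (restrict_space borel ?A)"
    by (rule borel_measurable_mono_on_fnc)
  then have "(\<lambda>\<alpha>. - (- ?f \<alpha>)) \<in> borel_measurable (restrict_space borel ?A)"
    by (rule borel_measurable_uminus)
  then have "?f \<in> borel_measurable (restrict_space borel ?A)"
    by simp
  \<comment> \<open>The constant \<open>?f 0\<close> makes the extension agree with the spread at
    the endpoint 0 too, whatever value the expectiles take there.\<close>
  then have "(\<lambda>\<alpha>. if \<alpha> \<in> ?A then ?f \<alpha> else ?f 0) \<in> borel_measurable borel"
    by (subst (asm) measurable_restrict_space_iff) auto
  then have "(\<lambda>\<alpha>. if \<alpha> \<in> ?A then ?f \<alpha> else ?f 0) \<in> borel_measurable (lebesgue_on {0..1/2})"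
    by (intro measurable_restrict_space1 measurable_completion) simp
  also have "?this \<longleftrightarrow> ?thesis"
    by (intro measurable_cong) auto
  finally show ?thesis .
qed

section \<open>Consequences of the convex order\<close>

lemma ext_expectation_integrable:
  assumes "integrable M Z"
  shows "ext_expectation M Z = ereal (expectation Z)"
proof -
  obtain r q where rq: "0 \<le> r" "0 \<le> q" "(\<integral>\<^sup>+\<omega>. ennreal (Z \<omega>) \<partial>M) = ennreal r"
      "(\<integral>\<^sup>+\<omega>. ennreal (- Z \<omega>) \<partial>M) = ennreal q" "expectation Z = r - q"
    using integrableE[OF assms] by metis
  then show ?thesis by (simp add: ext_expectation_def enn2ereal_ennreal)
qed

lemma convex_order_expectation_le:
  assumes "convex_order M X Y" "convex_on UNIV \<phi>"
    and "integrable M (\<lambda>\<omega>. \<phi> (X \<omega>))" "integrable M (\<lambda>\<omega>. \<phi> (Y \<omega>))"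
  shows "expectation (\<lambda>\<omega>. \<phi> (X \<omega>)) \<le> expectation (\<lambda>\<omega>. \<phi> (Y \<omega>))"
  using assms unfolding convex_order_def by (metis ereal_less_eq(3) ext_expectation_integrable)

text \<open>The identity and its negative are both convex, which gives the two inequalities.\<close>

lemma convex_order_expectation_eq:
  assumes "convex_order M X Y" "integrable M X" "integrable M Y"
  shows "expectation X = expectation Y"
  using convex_order_expectation_le[OF assms(1), of "\<lambda>x. x"]
    convex_order_expectation_le[OF assms(1), of "\<lambda>x. - x"] assms(2,3)
  by (simp add: convex_on_def algebra_simps)

text \<open>The stop-loss integrand is itself a convex test function, with integrable
  values.\<close>

lemma convex_order_stop_loss_le:
  assumes "convex_order M X Y" "integrable M X" "integrable M Y"
  shows "stop_loss M X e \<le> stop_loss M Y e"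
proof -
  have "convex_on UNIV (\<lambda>x::real. max 0 (x - e))"
  proof (rule convex_onI)
    fix t x y :: real
    assume t: "0 < t" "t < 1"
    have "(1 - t) * x + t * y - e = (1 - t) * (x - e) + t * (y - e)"
      by (simp add: algebra_simps)
    also have "\<dots> \<le> (1 - t) * max 0 (x - e) + t * max 0 (y - e)"
      using t by (intro add_mono mult_left_mono) auto
    finally show "max 0 ((1 - t) *\<^sub>R x + t *\<^sub>R y - e)
        \<le> (1 - t) * max 0 (x - e) + t * max 0 (y - e)"
      using t by simp
  qed simp
  then show ?thesis
    unfolding stop_loss_def
    by (rule convex_order_expectation_le[OF assms(1)]) (intro integrable_stop_loss assms)+
qed

section \<open>Normalization, scale invariance and law invariance\<close>

lemma stop_loss_divide:
  assumes "0 < c"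
  shows "stop_loss M (\<lambda>\<omega>. X \<omega> / c) e = stop_loss M X (c * e) / c"
proof -
  have "(\<lambda>\<omega>. max 0 (X \<omega> / c - e)) = (\<lambda>\<omega>. max 0 (X \<omega> - c * e) / c)"
    using assms by (auto simp: max_def field_simps fun_eq_iff)
  then show ?thesis by (simp add: stop_loss_def)
qed

text \<open>Domination by 1 + |x|^p: the constant covers |x| \<le> 1, the power covers the rest, and
  constants are integrable on a probability space.\<close>

lemma Lp_nonneg_integrable:
  assumes "X \<in> Lp_nonneg M p" "1 \<le> p"
  shows "integrable M X"
proof (rule Bochner_Integration.integrable_bound)
  show "integrable M (\<lambda>\<omega>. 1 + \<bar>X \<omega>\<bar> powr p)"
    using assms by (simp add: Lp_nonneg_def)
  show "X \<in> borel_measurable M" using assms by (simp add: Lp_nonneg_def)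
  have "\<bar>x\<bar> \<le> 1 + \<bar>x\<bar> powr p" for x :: real
  proof (cases "\<bar>x\<bar> \<le> 1")
    case False
    then have "\<bar>x\<bar> powr 1 \<le> \<bar>x\<bar> powr p" using assms(2) by (intro powr_mono) auto
    then show ?thesis using False by simp
  qed (use powr_ge_zero[of "\<bar>x\<bar>" p] in linarith)
  then show "AE \<omega> in M. norm (X \<omega>) \<le> norm (1 + \<bar>X \<omega>\<bar> powr p)"
    by (intro AE_I2) (simp add: abs_of_nonneg)
qed

text \<open>All rests on the mean being positive: a nonnegative variable with mean zero vanishes
  almost surely.\<close>

lemma normalized_nonneg_props:
  assumes X: "X \<in> Lp_nonneg M p" "1 \<le> p" "\<not> (AE \<omega> in M. X \<omega> = 0)"
  shows "0 < expectation X"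
    and "integrable M (normalized M X)"
    and "AE \<omega> in M. 0 \<le> normalized M X \<omega>"
    and "expectation (normalized M X) = 1"
proof -
  have int: "integrable M X" using X Lp_nonneg_integrable by blast
  have nn: "AE \<omega> in M. 0 \<le> X \<omega>" using X by (simp add: Lp_nonneg_def)
  show pos: "0 < expectation X"
    using integral_nonneg_eq_0_iff_AE[OF int nn] integral_nonneg_AE[OF nn] X(3) by simp
  show "integrable M (normalized M X)" using int by (simp add: normalized_def)
  show "AE \<omega> in M. 0 \<le> normalized M X \<omega>"
    using nn pos by (auto simp: normalized_def)
  show "expectation (normalized M X) = 1"
    using pos by (simp add: normalized_def)
qed

text \<open>The factor cancels in the quotient. Default values respect this: if the mean evaluates
  to 0, both sides are 0 because division by 0 yields 0.\<close>

lemma normalized_scale: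
  assumes "t \<noteq> 0"
  shows "normalized M (\<lambda>\<omega>. t * X \<omega>) = normalized M X"
  using assms by (simp add: normalized_def)

lemma expectile_index_scale:
  assumes "t \<noteq> 0"
  shows "expectile_index M \<psi> (\<lambda>\<omega>. t * X \<omega>) = expectile_index M \<psi> X"
  using assms by (simp add: expectile_index_def normalized_scale)

lemma expectile_index_distr_cong:
  assumes X[measurable]: "X \<in> borel_measurable M" and Y[measurable]: "Y \<in> borel_measurable M"
    and eq: "distr M borel X = distr M borel Y"
  shows "expectile_index M \<psi> X = expectile_index M \<psi> Y"
proof -
  \<comment> \<open>Expectations of Borel functions of a variable are integrals against its law.
    Hence the means agree, and so do the equations defining the expectiles at every level.\<close>
  have E: "expectation (\<lambda>\<omega>. g (X \<omega>)) = expectation (\<lambda>\<omega>. g (Y \<omega>))"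
    if [measurable]: "g \<in> borel_measurable borel" for g :: "real \<Rightarrow> real"
    by (metis X Y eq integral_distr that)
  have mean: "expectation X = expectation Y" using E[of "\<lambda>x. x"] by simp
  have "expectile M (normalized M X) = expectile M (normalized M Y)"
    unfolding expectile_def normalized_def mean
    using E[of "\<lambda>x. max 0 (- (x / expectation Y - e))" for e]
      E[of "\<lambda>x. max 0 (x / expectation Y - e)" for e]
    by (simp add: fun_eq_iff)
  moreover have "(AE \<omega> in M. X \<omega> = 0) \<longleftrightarrow> (AE \<omega> in M. Y \<omega> = 0)"
    using AE_distr_iff[OF X, of "\<lambda>x. x = 0"] AE_distr_iff[OF Y, of "\<lambda>x. x = 0"]
    unfolding eq by (simp add: pred_def[symmetric])
  ultimately show ?thesis
    by (simp add: expectile_index_def expectile_spread_def)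
qed

end

section \<open>Integration over the level against the weight \<psi>\<close>

lemma AE_lebesgue_on_pos: "AE \<alpha> in lebesgue_on {0..1/2::real}. 0 < \<alpha> \<and> \<alpha> \<le> 1 / 2"
proof -
  have "AE \<alpha> in lebesgue. \<alpha> \<noteq> (0::real)"
    by (intro AE_completion AE_lborel_singleton)
  then have "AE \<alpha> in lebesgue. \<alpha> \<in> {0..1/2} \<longrightarrow> 0 < \<alpha> \<and> \<alpha> \<le> (1 / 2 :: real)"
    by eventually_elim auto
  then show ?thesis
    by (simp add: AE_restrict_space_iff)
qed

context prob_space
begin

context
  fixes \<psi> :: "real \<Rightarrow> real"
  assumes \<psi>_meas: "\<psi> \<in> borel_measurable (lebesgue_on {0..1/2})"
    and \<psi>_nonneg: "\<And>\<alpha>. \<alpha> \<in> {0..1/2} \<Longrightarrow> 0 \<le> \<psi> \<alpha>"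
    and kappa_fin: "kappa_plus \<psi> < \<infinity>"
begin

text \<open>Moves \<open>kappa_plus\<close> from the extended nonnegative integral to the Bochner
  integral, so that the weight can serve as an integrable majorant of known integral.\<close>

lemma weight_bochner:
  shows "integrable (lebesgue_on {0..1/2}) (\<lambda>\<alpha>. \<psi> \<alpha> * ((1 - 2 * \<alpha>) / (\<alpha> * (1 - \<alpha>))))"
    and "(\<integral>\<alpha>. \<psi> \<alpha> * ((1 - 2 * \<alpha>) / (\<alpha> * (1 - \<alpha>))) \<partial>lebesgue_on {0..1/2}) = enn2real (kappa_plus \<psi>)"
proof -
  let ?L = "lebesgue_on {0..1/2::real}"
  let ?w = "\<lambda>\<alpha>. \<psi> \<alpha> * ((1 - 2 * \<alpha>) / (\<alpha> * (1 - \<alpha>)))"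
  have "(\<lambda>\<alpha>::real. (1 - 2 * \<alpha>) / (\<alpha> * (1 - \<alpha>))) \<in> borel_measurable lborel"
    by measurable
  then have "(\<lambda>\<alpha>::real. (1 - 2 * \<alpha>) / (\<alpha> * (1 - \<alpha>))) \<in> borel_measurable ?L"
    by (intro measurable_restrict_space1 measurable_completion)
  then have meas: "?w \<in> borel_measurable ?L"
    using \<psi>_meas by (rule borel_measurable_times[rotated])
  have nn: "AE \<alpha> in ?L. 0 \<le> ?w \<alpha>"
    by (intro AE_I2) (auto intro!: mult_nonneg_nonneg divide_nonneg_nonneg \<psi>_nonneg)
  show "integrable ?L ?w"
    using kappa_fin by (intro integrableI_nonneg meas nn) (simp add: kappa_plus_def)
  show "integral\<^sup>L ?L ?w = enn2real (kappa_plus \<psi>)"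
    unfolding kappa_plus_def by (intro integral_eq_nn_integral meas nn)
qed

lemma AE_spread_bounds:
  assumes "X \<in> Lp_nonneg M p" "1 \<le> p" "\<not> (AE \<omega> in M. X \<omega> = 0)"
  shows "AE \<alpha> in lebesgue_on {0..1/2}. 0 \<le> \<psi> \<alpha> * expectile_spread M (normalized M X) \<alpha>
     \<and> \<psi> \<alpha> * expectile_spread M (normalized M X) \<alpha> \<le> \<psi> \<alpha> * ((1 - 2 * \<alpha>) / (\<alpha> * (1 - \<alpha>)))"
  \<comment> \<open>The pointwise bounds on the spread require a positive level, so the null set at
    0 is discarded first.\<close>
  using AE_lebesgue_on_pos
proof eventually_elim
  case (elim \<alpha>)
  note X = normalized_nonneg_props[OF assms]
  show ?case
    using elim
    by (intro conjI mult_left_mono mult_nonneg_nonneg expectile_spread_nonneg[OF X(2)]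
        expectile_spread_le[OF X(2-4)] \<psi>_nonneg) auto
qed

lemma integrable_expectile_spread:
  assumes "X \<in> Lp_nonneg M p" "1 \<le> p" "\<not> (AE \<omega> in M. X \<omega> = 0)"
  shows "integrable (lebesgue_on {0..1/2}) (\<lambda>\<alpha>. \<psi> \<alpha> * expectile_spread M (normalized M X) \<alpha>)"
proof (rule Bochner_Integration.integrable_bound[OF weight_bochner(1)])
  show "(\<lambda>\<alpha>. \<psi> \<alpha> * expectile_spread M (normalized M X) \<alpha>) \<in> borel_measurable (lebesgue_on {0..1/2})"
    using \<psi>_meas borel_measurable_expectile_spread[OF normalized_nonneg_props(2)[OF assms]]
    by (rule borel_measurable_times)
  show "AE \<alpha> in lebesgue_on {0..1/2}. norm (\<psi> \<alpha> * expectile_spread M (normalized M X) \<alpha>)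
      \<le> norm (\<psi> \<alpha> * ((1 - 2 * \<alpha>) / (\<alpha> * (1 - \<alpha>))))"
    using AE_spread_bounds[OF assms] by eventually_elim (simp only: real_norm_def, linarith)
qed

text \<open>Integrating \<open>AE_spread_bounds\<close> bounds the integral by 0 and by exactly the
  constant that normalizes the index.\<close>

lemma expectile_index_bounds:
  assumes "X \<in> Lp_nonneg M p" "1 \<le> p"
  shows "expectile_index M \<psi> X \<in> {0..1}"
proof (cases "AE \<omega> in M. X \<omega> = 0")
  case False
  note X = assms False
  let ?I = "\<integral>\<alpha>. \<psi> \<alpha> * expectile_spread M (normalized M X) \<alpha> \<partial>lebesgue_on {0..1/2}"
  have "0 \<le> ?I"
    by (rule integral_nonneg_AE) (use AE_spread_bounds[OF X] in \<open>eventually_elim, blast\<close>)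
  moreover have "?I \<le> enn2real (kappa_plus \<psi>)"
    unfolding weight_bochner(2)[symmetric]
    by (intro integral_mono_AE integrable_expectile_spread[OF X] weight_bochner(1))
      (use AE_spread_bounds[OF X] in \<open>eventually_elim, blast\<close>)
  ultimately show ?thesis
    using False by (auto simp: expectile_index_def divide_le_eq_1)
qed (simp add: expectile_index_def)

text \<open>Convex order forces equal means, so both variables are divided by the same positive
  number. Their stop-loss transforms stay ordered, hence so do the spreads at almost every level,
  and integration preserves this.\<close>

lemma expectile_index_mono_convex_order:
  assumes X: "X \<in> Lp_nonneg M p" and Y: "Y \<in> Lp_nonneg M p" and p: "1 \<le> p"
    and le: "convex_order M X Y"
  shows "expectile_index M \<psi> X \<le> expectile_index M \<psi> Y"
proof (cases "AE \<omega> in M. X \<omega> = 0")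
  case True
  then show ?thesis
    using expectile_index_bounds[OF Y p] by (simp add: expectile_index_def)
next
  case False
  note intX = Lp_nonneg_integrable[OF X p] and intY = Lp_nonneg_integrable[OF Y p]
  note nX = normalized_nonneg_props[OF X p False]
  have mean: "expectation X = expectation Y"
    by (rule convex_order_expectation_eq[OF le intX intY])
  \<comment> \<open>The mean of \<open>Y\<close> equals the positive mean of \<open>X\<close>, so
    \<open>Y\<close> cannot vanish almost surely and both indices are given by the integral
    formula.\<close>
  then have Y0: "\<not> (AE \<omega> in M. Y \<omega> = 0)"
    using nX(1) integral_eq_zero_AE[of Y M] by auto
  note nY = normalized_nonneg_props[OF Y p Y0]
  have sl: "stop_loss M (normalized M X) e \<le> stop_loss M (normalized M Y) e" for e
    unfolding normalized_def mean using nY(1)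
    by (simp add: stop_loss_divide divide_right_mono convex_order_stop_loss_le[OF le intX intY])
  have "AE \<alpha> in lebesgue_on {0..1/2}. \<psi> \<alpha> * expectile_spread M (normalized M X) \<alpha>
      \<le> \<psi> \<alpha> * expectile_spread M (normalized M Y) \<alpha>"
    using AE_lebesgue_on_pos
  proof eventually_elim
    case (elim \<alpha>)
    then show ?case
      using expectile_spread_mono_stop_loss[OF nX(2) nY(2) _ sl] nX(4) nY(4) \<psi>_nonneg
      by (intro mult_left_mono) auto
  qed
  then have "(\<integral>\<alpha>. \<psi> \<alpha> * expectile_spread M (normalized M X) \<alpha> \<partial>lebesgue_on {0..1/2})
      \<le> (\<integral>\<alpha>. \<psi> \<alpha> * expectile_spread M (normalized M Y) \<alpha> \<partial>lebesgue_on {0..1/2})"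
    by (intro integral_mono_AE integrable_expectile_spread[OF X p False]
        integrable_expectile_spread[OF Y p Y0])
  then show ?thesis
    using False Y0 by (simp add: expectile_index_def divide_right_mono)
qed

end

end

text \<open>The integrability conjunct ensures that the Bochner integral in
  \<open>expectile_index\<close> is a genuine one and not the default value 0.\<close>

theorem mainTheorem2:
  fixes M :: "'a measure" and p :: real and \<psi> :: "real \<Rightarrow> real"
  assumes "prob_space M" and "complete_measure M"
    and "1 \<le> p"
    and "\<psi> \<in> borel_measurable (lebesgue_on {0..1/2})"
    and "\<And>\<alpha>. \<alpha> \<in> {0..1/2} \<Longrightarrow> 0 \<le> \<psi> \<alpha>"
    and "\<not> (AE \<alpha> in lebesgue_on {0..1/2}. \<psi> \<alpha> = 0)"
    and "kappa_plus \<psi> < \<infinity>"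
  shows "(\<forall>X \<in> Lp_nonneg M p. \<not> (AE \<omega> in M. X \<omega> = 0) \<longrightarrow>
        integrable (lebesgue_on {0..1/2}) (\<lambda>\<alpha>. \<psi> \<alpha> * expectile_spread M (normalized M X) \<alpha>)) \<and>
    (\<forall>X \<in> Lp_nonneg M p. \<forall>Y \<in> Lp_nonneg M p.
        distr M borel X = distr M borel Y \<longrightarrow> expectile_index M \<psi> X = expectile_index M \<psi> Y) \<and>
    (\<forall>X \<in> Lp_nonneg M p. expectile_index M \<psi> X \<in> {0..1}) \<and>
    (\<forall>X \<in> Lp_nonneg M p. \<forall>t > 0.
        expectile_index M \<psi> (\<lambda>\<omega>. t * X \<omega>) = expectile_index M \<psi> X) \<and>
    (\<forall>X \<in> Lp_nonneg M p. \<forall>Y \<in> Lp_nonneg M p.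
        convex_order M X Y \<longrightarrow> expectile_index M \<psi> X \<le> expectile_index M \<psi> Y)"
proof -
  interpret prob_space M by fact
  show ?thesis
  proof (intro conjI ballI allI impI)
    fix X Y assume "X \<in> Lp_nonneg M p" "Y \<in> Lp_nonneg M p" "distr M borel X = distr M borel Y"
    then show "expectile_index M \<psi> X = expectile_index M \<psi> Y"
      by (intro expectile_index_distr_cong) (simp_all add: Lp_nonneg_def)
  next
    fix X :: "'a \<Rightarrow> real" and t :: real assume "0 < t"
    then show "expectile_index M \<psi> (\<lambda>\<omega>. t * X \<omega>) = expectile_index M \<psi> X"
      by (intro expectile_index_scale) simp
  qed (rule integrable_expectile_spread[OF assms(4,5,7) _ assms(3)]
      expectile_index_bounds[OF assms(4,5,7) _ assms(3)]
      expectile_index_mono_convex_order[OF assms(4,5,7) _ _ assms(3)]; assumption)+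
qed

end
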